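(* Let $t$ be a positive integer with $t\equiv 25\pmod{56}$. Then $18107_2^{(t)}=18107\cdot(2^{15t}-1)/(2^{15}-1)$ is a Sierpiński number.
   Context: A Sierpiński number is an odd positive integer $k$ such that $k\cdot 2^n+1$ is composite for all positive integers $n$. For integers $b\ge2$, $k\ge1$, $t\ge1$, the $b$-repinteger is $k_b^{(t)}=k\,(b^{\ell t}-1)/(b^\ell-1)$ with $\ell=\lfloor\log_b k\rfloor+1$; for $k=18107$, $b=2$ one has $\ell=15$. *)

theory Defs
  imports Complex_Main "HOL-Number_Theory.Number_Theory"
begin

definition composite :: "nat \<Rightarrow> bool" where
  "composite m \<longleftrightarrow> m > 1 \<and> \<not> prime m"

text \<open>Over \<^typ>\<open>nat\<close>, oddness already forces \<open>k\<close> to be positive.\<close>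

definition sierpinski_number :: "nat \<Rightarrow> bool" where
  "sierpinski_number k \<longleftrightarrow> odd k \<and> (\<forall>n::nat. n > 0 \<longrightarrow> composite (k * 2 ^ n + 1))"

text \<open>The number of base-\<open>b\<close> digits of \<open>k\<close>, and the integer obtained by writing the base-\<open>b\<close>
  expansion of \<open>k\<close> down \<open>t\<close> times in a row. Both are meant for \<open>b \<ge> 2\<close> and \<open>k, t \<ge> 1\<close>.\<close>

definition digit_length :: "nat \<Rightarrow> nat \<Rightarrow> nat" where
  "digit_length b k = nat \<lfloor>log (real b) (real k)\<rfloor> + 1"

definition repinteger :: "nat \<Rightarrow> nat \<Rightarrow> nat \<Rightarrow> nat" where
  "repinteger b k t =
     k * (b ^ (digit_length b k * t) - 1) div (b ^ digit_length b k - 1)"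

text \<open>The truncating operations on \<^typ>\<open>nat\<close> are exact here.\<close>

lemma repinteger_real:
  assumes "b \<ge> 2"
  shows "real (repinteger b k t) =
    real k * (real b ^ (digit_length b k * t) - 1) / (real b ^ digit_length b k - 1)"
proof -
  define l where "l = digit_length b k"
  have ge: "b ^ m \<ge> 1" for m
    using assms by simp
  have "int (b ^ l) - 1 dvd int (b ^ l) ^ t - 1"
    by (metis dvd_triv_left power_diff_1_eq)
  also have "int (b ^ l) - 1 = int (b ^ l - 1)"
    using ge[of l] by (simp add: of_nat_diff)
  also have "int (b ^ l) ^ t - 1 = int (b ^ (l * t) - 1)"
    using ge[of "l * t"] by (simp add: of_nat_diff power_mult)
  finally have "b ^ l - 1 dvd b ^ (l * t) - 1"
    by (simp only: int_dvd_int_iff)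
  then have "b ^ l - 1 dvd k * (b ^ (l * t) - 1)"
    by simp
  then have "real (k * (b ^ (l * t) - 1) div (b ^ l - 1)) =
      real (k * (b ^ (l * t) - 1)) / real (b ^ l - 1)"
    by (rule real_of_nat_div)
  then show ?thesis
    using ge[of l] ge[of "l * t"]
    by (simp add: repinteger_def l_def of_nat_diff)
qed

end

theory Submission
  imports Defs
begin

text \<open>
  The primes 3, 5, 7, 13, 17, 241 have product \<open>5592405\<close>, which divides \<open>2 ^ 24 - 1\<close>, so the
  residue of \<open>k * 2 ^ n + 1\<close> modulo this product depends only on \<open>k\<close> modulo the product and on
  \<open>n\<close> modulo 24. Likewise \<open>2 ^ (15 * 56) \<equiv> 1\<close> modulo \<open>5592405 * (2 ^ 15 - 1)\<close>, hence \<open>t \<equiv> 25\<close>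
  modulo 56 fixes the residue of \<open>18107 * (2 ^ (15 * t) - 1) / (2 ^ 15 - 1)\<close> modulo \<open>5592405\<close>.
  For that residue, \<open>2414852\<close>, the six primes cover all exponents: they divide \<open>k * 2 ^ n + 1\<close> for
  \<open>n \<equiv> 0 (2)\<close>, \<open>1 (4)\<close>, \<open>0 (3)\<close>, \<open>11 (12)\<close>, \<open>3 (8)\<close>, \<open>7 (24)\<close> respectively.
\<close>

lemma cong_pow_of_cong_1:
  fixes a :: "'a :: unique_euclidean_semiring"
  assumes "[a ^ d = 1] (mod m)" and "[i = j] (mod d)"
  shows "[a ^ i = a ^ j] (mod m)"
proof -
  have red: "[a ^ l = a ^ (l mod d)] (mod m)" for l
  proof -
    have "[(a ^ d) ^ (l div d) * a ^ (l mod d) = 1 ^ (l div d) * a ^ (l mod d)] (mod m)"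
      by (intro cong_mult cong_pow assms cong_refl)
    moreover have "(a ^ d) ^ (l div d) * a ^ (l mod d) = a ^ l"
      by (simp flip: power_mult power_add)
    ultimately show ?thesis
      by simp
  qed
  have "i mod d = j mod d"
    using assms(2) by (simp add: cong_def)
  then show ?thesis
    using red[of i] red[of j] by (metis cong_sym cong_trans)
qed

lemma composite_if_dvd:
  assumes "p dvd m" and "1 < p" and "p < m"
  shows "composite m"
  using assms prime_nat_iff by (auto simp: composite_def)

lemma digit_length_18107: "digit_length 2 18107 = 15"
proof -
  \<comment> \<open>This is \<open>2 ^ 14 = 16384 \<le> 18107 < 32768 = 2 ^ 15\<close>.\<close>
  have "\<lfloor>log 2 (18107::real)\<rfloor> = 14"
    by (subst floor_log_eq_powr_iff) simp_all
  then show ?thesis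
    by (simp add: digit_length_def)
qed

lemma repinteger_mult:
  "repinteger 2 18107 t * (2 ^ 15 - 1) = 18107 * (2 ^ (15 * t) - 1)"
proof -
  have "real (repinteger 2 18107 t * (2 ^ 15 - 1)) = real (18107 * (2 ^ (15 * t) - 1))"
    by (simp add: repinteger_real digit_length_18107)
  then show ?thesis
    by (simp only: of_nat_eq_iff)
qed

text \<open>As \<open>32767\<close> and \<open>5592405\<close> share the factor 7, one cannot divide
  by \<open>32767\<close> modulo \<open>5592405\<close>. The computation runs modulo their product,
  and \<open>32767\<close> is cancelled from both sides and the modulus at the end.\<close>

lemma repinteger_cong:
  assumes "[t = 25] (mod 56)"
  shows "[repinteger 2 18107 t = 2414852] (mod 5592405)"
proof -
  let ?k = "repinteger 2 18107 t"
  have "[15 * t = 15 * 25] (mod 15 * 56)"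
    using assms by (simp only: cong_def mult_mod_right[symmetric])
  moreover have "[(2::nat) ^ (15 * 56) = 1] (mod 32767 * 5592405)"
    unfolding cong_power_nat_code mod_exp_code by (simp add: mod_exp_aux_code)
  ultimately have "[2 ^ (15 * t) = (2::nat) ^ (15 * 25)] (mod 32767 * 5592405)"
    by (rule cong_pow_of_cong_1[rotated])
  also have "[(2::nat) ^ (15 * 25) = 52356128378] (mod 32767 * 5592405)"
    unfolding cong_power_nat_code mod_exp_code by (simp add: mod_exp_aux_code)
  finally have pow: "[2 ^ (15 * t) = (52356128378::nat)] (mod 32767 * 5592405)" .
  \<comment> \<open>The additive form avoids truncated subtraction.\<close>
  have "32767 * ?k + 18107 = 18107 * 2 ^ (15 * t)"
    using repinteger_mult[of t] by (simp add: diff_mult_distrib2 algebra_simps)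
  then have "[32767 * ?k + 18107 = 18107 * 2 ^ (15 * t)] (mod 32767 * 5592405)"
    by (simp only: cong_refl)
  also have "[18107 * 2 ^ (15 * t) = 18107 * (52356128378::nat)] (mod 32767 * 5592405)"
    using pow by (rule cong_scalar_left)
  also have "[18107 * 52356128378 = 32767 * 2414852 + (18107::nat)] (mod 32767 * 5592405)"
    by (simp add: cong_def)
  finally have "[32767 * ?k = 32767 * 2414852] (mod 32767 * 5592405)"
    by (simp only: cong_add_rcancel_nat)
  then show ?thesis
    by (simp only: cong_def mult_mod_right[symmetric] mult_cancel_left numeral_neq_zero simp_thms)
qed

lemma covering:
  fixes k n :: nat
  assumes "[k = 2414852] (mod 5592405)"
  shows "\<exists>p \<in> {3, 5, 7, 13, 17, 241}. p dvd k * 2 ^ n + 1"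
proof -
  have "[(2::nat) ^ n = 2 ^ (n mod 24)] (mod 5592405)"
    by (rule cong_pow_of_cong_1[where d = 24]) (simp_all add: cong_def)
  then have main: "[k * 2 ^ n + 1 = 2414852 * 2 ^ (n mod 24) + 1] (mod 5592405)"
    using assms by (intro cong_add cong_mult cong_refl)
  have "\<forall>r \<in> {..<24}. \<exists>p \<in> {3, 5, 7, 13, 17, 241}. p dvd 2414852 * 2 ^ r + (1::nat)"
    by (simp add: lessThan_nat_numeral lessThan_Suc)
  moreover have "n mod 24 \<in> {..<24}"
    by simp
  ultimately obtain p :: nat
    where p: "p \<in> {3, 5, 7, 13, 17, 241}" "p dvd 2414852 * 2 ^ (n mod 24) + 1"
    by blast
  from p(1) have "p dvd 5592405"
    by auto
  then have "[k * 2 ^ n + 1 = 2414852 * 2 ^ (n mod 24) + 1] (mod p)"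
    using main by (rule cong_dvd_modulus_nat[rotated])
  then show ?thesis
    using p cong_dvd_iff by blast
qed

theorem theorem3p5:
  fixes t :: nat
  assumes "t > 0" and "[t = 25] (mod 56)"
  shows "real (repinteger 2 18107 t) = 18107 * (2 ^ (15 * t) - 1) / (2 ^ 15 - 1)
    \<and> sierpinski_number (repinteger 2 18107 t)"
proof
  let ?k = "repinteger 2 18107 t"
  show "real ?k = 18107 * (2 ^ (15 * t) - 1) / (2 ^ 15 - 1)"
    by (simp add: repinteger_real digit_length_18107)
  \<comment> \<open>For \<open>t > 0\<close> the power of 2 is even; a factor of an odd product is
    odd.\<close>
  have "odd (18107 * (2 ^ (15 * t) - 1) :: nat)"
    using assms(1) by simp
  then have "odd ?k"
    unfolding repinteger_mult[symmetric] by simp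
  have cong: "[?k = 2414852] (mod 5592405)"
    using assms(2) by (rule repinteger_cong)
  \<comment> \<open>A number is at least its residue, so \<open>?k\<close> exceeds all six primes
    and the divisor found is proper.\<close>
  then have "?k mod 5592405 = 2414852"
    by (simp add: cong_def)
  then have large: "?k > 241"
    using mod_less_eq_dividend[of ?k 5592405] by linarith
  have "composite (?k * 2 ^ n + 1)" for n
  proof -
    obtain p where p: "p \<in> {3, 5, 7, 13, 17, 241}" "p dvd ?k * 2 ^ n + 1"
      using covering[OF cong] by blast
    have "?k * 1 \<le> ?k * 2 ^ n"
      by (intro mult_le_mono2) simp
    moreover have "p \<le> 241"
      using p(1) by auto
    ultimately have "p < ?k * 2 ^ n + 1"
      using large by linarith
    with p show ?thesis
      by (intro composite_if_dvd[of p]) auto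
  qed
  with \<open>odd ?k\<close> show "sierpinski_number ?k"
    by (simp add: sierpinski_number_def)
qed

end
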